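(* Every linearly recurrent Cantor system $(X,T)$ is uniquely ergodic; that is, there is exactly one $T$-invariant Borel probability measure on $X$.
   Context: A Cantor system $(X,T)$ is a Cantor space $X$ together with a homeomorphism $T:X\to X$; it is minimal if the only closed $T$-invariant subsets are $\emptyset$ and $X$. $\mathbb N=\{0,1,2,\dots\}$. A clopen Kakutani-Rokhlin (CKR) partition of $X$ is a partition of $X$ of the form $\{T^{-j}B_k : 1\le k\le C,\ 0\le j<h_k\}$, where $C\ge 1$, $B_1,\dots,B_C$ are (nonempty) clopen subsets of $X$ and $h_1,\dots,h_C$ are positive integers; its base is $B=\bigcup_k B_k$. Consider a sequence of CKR partitions $\mathcal P(n)=\{T^{-j}B_k(n):1\le k\le C(n),\ 0\le j<h_k(n)\}$, $n\in\mathbb N$, with bases $B(n)$, where $\mathcal P(0)$ is trivial: $B(0)=X$, $C(0)=1$, $h_1(0)=1$. The following properties are considered: (KR1) $B(n+1)\subset B(n)$ for all $n\ge 0$; (KR2) for all $n\ge 0$ every element of $\mathcal P(n+1)$ is contained in an element of $\mathcal P(n)$; (KR3) $\bigcap_{n} B(n)$ is a single point; (KR4) the sequence of partitions spans the topology of $X$; (KR5) for all $n\ge1$, $1\le k\le C(n-1)$, $1\le l\le C(n)$ there is $0\le j<h_l(n)$ with $T^{-j}B_l(n)\subset B_k(n-1)$; (KR6) $B(n+1)\subset B_1(n)$ for all $n\in\mathbb N$. The sequence is nested if (KR1) and (KR2) hold. A minimal Cantor system $(X,T)$ is linearly recurrent (with constant $L$) if there is such a sequence satisfying (KR1)-(KR6)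 and (LR) there is $L$ such that $h_l(n)\le L\,h_k(n-1)$ for all $n\ge1$, $1\le l\le C(n)$, $1\le k\le C(n-1)$. *)

theory Defs
  imports "HOL-Analysis.Analysis" "HOL-Probability.Probability"
begin

definition totally_disconnected_space :: "'a topology \<Rightarrow> bool" where
  "totally_disconnected_space X \<longleftrightarrow>
     (\<forall>S. connectedin X S \<longrightarrow> (\<forall>x\<in>S. \<forall>y\<in>S. x = y))"

(* The last conjunct says that X has no isolated points. *)
definition cantor_space :: "'a topology \<Rightarrow> bool" where
  "cantor_space X \<longleftrightarrow>
     topspace X \<noteq> {} \<and> compact_space X \<and> metrizable_space X \<and>
     totally_disconnected_space X \<and> X derived_set_of topspace X = topspace X"

definition cantor_system :: "'a topology \<Rightarrow> ('a \<Rightarrow> 'a) \<Rightarrow> bool" where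
  "cantor_system X T \<longleftrightarrow> cantor_space X \<and> homeomorphic_map X X T"

(* Invariance is read as T(A) = A; since X is compact, the reading T(A) contained in A
   yields the same notion of minimality. *)
definition minimal_cantor_system :: "'a topology \<Rightarrow> ('a \<Rightarrow> 'a) \<Rightarrow> bool" where
  "minimal_cantor_system X T \<longleftrightarrow>
     cantor_system X T \<and> (\<forall>A. closedin X A \<and> T ` A = A \<longrightarrow> A = {} \<or> A = topspace X)"

(* The map T is only meaningful on topspace X, so T^(-j)(A) is a preimage cut down to topspace X. *)
definition preim :: "'a topology \<Rightarrow> ('a \<Rightarrow> 'a) \<Rightarrow> nat \<Rightarrow> 'a set \<Rightarrow> 'a set" where
  "preim X T j A = (T ^^ j) -` A \<inter> topspace X"

(* A clopen Kakutani-Rokhlin partition is given by its number C of towers, the tower bases B k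
   and the heights h k; only the values at 1 <= k <= C matter. *)
definition ckr_cells ::
  "'a topology \<Rightarrow> ('a \<Rightarrow> 'a) \<Rightarrow> nat \<Rightarrow> (nat \<Rightarrow> 'a set) \<Rightarrow> (nat \<Rightarrow> nat) \<Rightarrow> 'a set set" where
  "ckr_cells X T C B h = {preim X T j (B k) | k j. 1 \<le> k \<and> k \<le> C \<and> j < h k}"

definition ckr_base :: "nat \<Rightarrow> (nat \<Rightarrow> 'a set) \<Rightarrow> 'a set" where
  "ckr_base C B = (\<Union>k\<in>{1..C}. B k)"

(* The cells are pairwise disjoint as a family indexed by (k, j): distinct indices give
   distinct cells. *)
definition ckr_partition ::
  "'a topology \<Rightarrow> ('a \<Rightarrow> 'a) \<Rightarrow> nat \<Rightarrow> (nat \<Rightarrow> 'a set) \<Rightarrow> (nat \<Rightarrow> nat) \<Rightarrow> bool" where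
  "ckr_partition X T C B h \<longleftrightarrow>
     1 \<le> C \<and>
     (\<forall>k\<in>{1..C}. B k \<noteq> {} \<and> openin X (B k) \<and> closedin X (B k) \<and> 0 < h k) \<and>
     disjoint_family_on (\<lambda>(k, j). preim X T j (B k)) (SIGMA k:{1..C}. {..<h k}) \<and>
     \<Union> (ckr_cells X T C B h) = topspace X"

(* In a sequence of partitions the first argument of B and h is the level n. *)
definition ckr_sequence ::
  "'a topology \<Rightarrow> ('a \<Rightarrow> 'a) \<Rightarrow> (nat \<Rightarrow> nat) \<Rightarrow> (nat \<Rightarrow> nat \<Rightarrow> 'a set) \<Rightarrow> (nat \<Rightarrow> nat \<Rightarrow> nat) \<Rightarrow> bool" where
  "ckr_sequence X T C B h \<longleftrightarrow>
     (\<forall>n. ckr_partition X T (C n) (B n) (h n)) \<and>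
     C 0 = 1 \<and> B 0 1 = topspace X \<and> h 0 1 = 1"

definition KR1 :: "(nat \<Rightarrow> nat) \<Rightarrow> (nat \<Rightarrow> nat \<Rightarrow> 'a set) \<Rightarrow> bool" where
  "KR1 C B \<longleftrightarrow> (\<forall>n. ckr_base (C (Suc n)) (B (Suc n)) \<subseteq> ckr_base (C n) (B n))"

definition KR2 ::
  "'a topology \<Rightarrow> ('a \<Rightarrow> 'a) \<Rightarrow> (nat \<Rightarrow> nat) \<Rightarrow> (nat \<Rightarrow> nat \<Rightarrow> 'a set) \<Rightarrow> (nat \<Rightarrow> nat \<Rightarrow> nat) \<Rightarrow> bool" where
  "KR2 X T C B h \<longleftrightarrow>
     (\<forall>n. \<forall>P\<in>ckr_cells X T (C (Suc n)) (B (Suc n)) (h (Suc n)).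
        \<exists>Q\<in>ckr_cells X T (C n) (B n) (h n). P \<subseteq> Q)"

definition KR3 :: "(nat \<Rightarrow> nat) \<Rightarrow> (nat \<Rightarrow> nat \<Rightarrow> 'a set) \<Rightarrow> bool" where
  "KR3 C B \<longleftrightarrow> (\<exists>x. (\<Inter>n. ckr_base (C n) (B n)) = {x})"

definition KR4 ::
  "'a topology \<Rightarrow> ('a \<Rightarrow> 'a) \<Rightarrow> (nat \<Rightarrow> nat) \<Rightarrow> (nat \<Rightarrow> nat \<Rightarrow> 'a set) \<Rightarrow> (nat \<Rightarrow> nat \<Rightarrow> nat) \<Rightarrow> bool" where
  "KR4 X T C B h \<longleftrightarrow>
     topology_generated_by (\<Union>n. ckr_cells X T (C n) (B n) (h n)) = X"

definition KR5 ::
  "'a topology \<Rightarrow> ('a \<Rightarrow> 'a) \<Rightarrow> (nat \<Rightarrow> nat) \<Rightarrow> (nat \<Rightarrow> nat \<Rightarrow> 'a set) \<Rightarrow> (nat \<Rightarrow> nat \<Rightarrow> nat) \<Rightarrow> bool" where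
  "KR5 X T C B h \<longleftrightarrow>
     (\<forall>n\<ge>1. \<forall>k\<in>{1..C (n - 1)}. \<forall>l\<in>{1..C n}.
        \<exists>j<h n l. preim X T j (B n l) \<subseteq> B (n - 1) k)"

definition KR6 :: "(nat \<Rightarrow> nat) \<Rightarrow> (nat \<Rightarrow> nat \<Rightarrow> 'a set) \<Rightarrow> bool" where
  "KR6 C B \<longleftrightarrow> (\<forall>n. ckr_base (C (Suc n)) (B (Suc n)) \<subseteq> B n 1)"

definition LR :: "real \<Rightarrow> (nat \<Rightarrow> nat) \<Rightarrow> (nat \<Rightarrow> nat \<Rightarrow> nat) \<Rightarrow> bool" where
  "LR L C h \<longleftrightarrow>
     (\<forall>n\<ge>1. \<forall>l\<in>{1..C n}. \<forall>k\<in>{1..C (n - 1)}. real (h n l) \<le> L * real (h (n - 1) k))"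

definition linearly_recurrent :: "'a topology \<Rightarrow> ('a \<Rightarrow> 'a) \<Rightarrow> bool" where
  "linearly_recurrent X T \<longleftrightarrow>
     minimal_cantor_system X T \<and>
     (\<exists>C B h. ckr_sequence X T C B h \<and>
        KR1 C B \<and> KR2 X T C B h \<and> KR3 C B \<and> KR4 X T C B h \<and> KR5 X T C B h \<and> KR6 C B \<and>
        (\<exists>L. LR L C h))"

definition borel_of :: "'a topology \<Rightarrow> 'a measure" where
  "borel_of X = sigma (topspace X) {U. openin X U}"

definition invariant_borel_prob :: "'a topology \<Rightarrow> ('a \<Rightarrow> 'a) \<Rightarrow> 'a measure \<Rightarrow> bool" where
  "invariant_borel_prob X T M \<longleftrightarrow>
     prob_space M \<and> sets M = sets (borel_of X) \<and>
     (\<forall>A\<in>sets M. emeasure M (T -` A \<inter> space M) = emeasure M A)"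

definition uniquely_ergodic :: "'a topology \<Rightarrow> ('a \<Rightarrow> 'a) \<Rightarrow> bool" where
  "uniquely_ergodic X T \<longleftrightarrow> (\<exists>!M. invariant_borel_prob X T M)"

end

theory Submission
  imports Defs
begin

text \<open>
  Uniqueness. An invariant probability is determined by the weights \<open>p n k\<close> it gives to the
  tower bases. By (KR5) every \<open>p n k\<close> is at least \<open>\<Sum>l. p (n + 1) l\<close>, and since the heights at
  level \<open>n + 1\<close> are at most \<open>L * h n k\<close>, this sum is at least \<open>1 / (L * h n k)\<close>. Hence
  \<open>1 / L \<le> h n k * p n k \<le> 1\<close>, so any two such weights satisfy \<open>p \<ge> q / L\<close>. If
  \<open>p \<ge> c q\<close>, applying the same bound to \<open>p - c q\<close>, whose total mass is \<open>1 - c\<close>,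
  improves \<open>c\<close> to \<open>c + (1 - c) / L\<close>; iterating gives \<open>p \<ge> q\<close>, and by symmetry equality.

  Existence. A cluster point of the orbit averages in the compact product of unit intervals
  indexed by all sets is a finitely additive invariant mean. On clopen sets it is countably
  additive by compactness, and the clopen sets generate the Borel sets by (KR4).
\<close>

section \<open>Weights on towers with linearly bounded heights\<close>

text \<open>An abstract record of the masses that an invariant measure of total mass
  \<open>s\<close> gives to the tower bases; \<open>m n l k\<close> stands for the number of visits
  of tower \<open>l\<close> of level \<open>n + 1\<close> to base \<open>k\<close> of level
  \<open>n\<close>, the incidence matrix of the associated Bratteli diagram.\<close>

definition weight_system ::
  "(nat \<Rightarrow> nat) \<Rightarrow> (nat \<Rightarrow> nat \<Rightarrow> nat) \<Rightarrow> (nat \<Rightarrow> nat \<Rightarrow> nat \<Rightarrow> nat) \<Rightarrow> real \<Rightarrow> (nat \<Rightarrow> nat \<Rightarrow> real) \<Rightarrow> bool" where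
  "weight_system C h m s p \<longleftrightarrow>
     (\<forall>n. \<forall>k\<in>{1..C n}. 0 \<le> p n k) \<and>
     (\<forall>n. (\<Sum>k\<in>{1..C n}. real (h n k) * p n k) = s) \<and>
     (\<forall>n. \<forall>k\<in>{1..C n}. p n k = (\<Sum>l\<in>{1..C (Suc n)}. real (m n l k) * p (Suc n) l))"

lemma weight_systemD:
  assumes "weight_system C h m s p"
  shows "\<And>n k. k \<in> {1..C n} \<Longrightarrow> 0 \<le> p n k"
    and "\<And>n. (\<Sum>k\<in>{1..C n}. real (h n k) * p n k) = s"
    and "\<And>n k. k \<in> {1..C n} \<Longrightarrow>
      p n k = (\<Sum>l\<in>{1..C (Suc n)}. real (m n l k) * p (Suc n) l)"
  using assms unfolding weight_system_def by blast+

text \<open>The mass and compatibility conditions are linear; only nonnegativity can fail under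
  subtraction, and \<open>le\<close> secures it.\<close>

lemma weight_system_diff:
  assumes p: "weight_system C h m s p" and q: "weight_system C h m t q"
    and le: "\<And>n k. k \<in> {1..C n} \<Longrightarrow> c * q n k \<le> p n k"
  shows "weight_system C h m (s - c * t) (\<lambda>n k. p n k - c * q n k)"
proof -
  have "(\<Sum>k\<in>{1..C n}. real (h n k) * (p n k - c * q n k)) = s - c * t" for n
  proof -
    have "(\<Sum>k\<in>{1..C n}. real (h n k) * (p n k - c * q n k)) =
        (\<Sum>k\<in>{1..C n}. real (h n k) * p n k) - c * (\<Sum>k\<in>{1..C n}. real (h n k) * q n k)"
      by (simp add: sum_subtractf sum_distrib_left algebra_simps)
    then show ?thesis using weight_systemD(2)[OF p] weight_systemD(2)[OF q] by simp
  qed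
  moreover have "p n k - c * q n k =
      (\<Sum>l\<in>{1..C (Suc n)}. real (m n l k) * (p (Suc n) l - c * q (Suc n) l))"
    if "k \<in> {1..C n}" for n k
  proof -
    have "(\<Sum>l\<in>{1..C (Suc n)}. real (m n l k) * (p (Suc n) l - c * q (Suc n) l)) =
        (\<Sum>l\<in>{1..C (Suc n)}. real (m n l k) * p (Suc n) l)
        - c * (\<Sum>l\<in>{1..C (Suc n)}. real (m n l k) * q (Suc n) l)"
      by (simp add: sum_subtractf sum_distrib_left algebra_simps)
    also have "\<dots> = p n k - c * q n k"
      by (simp only: weight_systemD(3)[OF p that] weight_systemD(3)[OF q that])
    finally show ?thesis by (rule sym)
  qed
  ultimately show ?thesis
    using le unfolding weight_system_def by (metis diff_ge_0_iff_ge)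
qed

locale linearly_bounded_towers =
  fixes C :: "nat \<Rightarrow> nat" and h :: "nat \<Rightarrow> nat \<Rightarrow> nat" and m :: "nat \<Rightarrow> nat \<Rightarrow> nat \<Rightarrow> nat"
    and L :: real
  assumes L_pos: "0 < L"
    and h_pos: "k \<in> {1..C n} \<Longrightarrow> 0 < h n k"
    and h_le: "l \<in> {1..C (Suc n)} \<Longrightarrow> k \<in> {1..C n} \<Longrightarrow> real (h (Suc n) l) \<le> L * real (h n k)"
    and m_pos: "l \<in> {1..C (Suc n)} \<Longrightarrow> k \<in> {1..C n} \<Longrightarrow> 0 < m n l k"
begin

text \<open>The total mass \<open>s\<close> is kept general so that the bound also applies to differences of weights.\<close>

lemma weight_lower_bound:
  assumes p: "weight_system C h m s p" and k: "k \<in> {1..C n}"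
  shows "s \<le> L * (real (h n k) * p n k)"
proof -
  have nn: "0 \<le> p n k" if "k \<in> {1..C n}" for n k
    by (rule weight_systemD(1)[OF p that])
  have "s = (\<Sum>l\<in>{1..C (Suc n)}. real (h (Suc n) l) * p (Suc n) l)"
    by (rule weight_systemD(2)[OF p, symmetric])
  \<comment> \<open>Termwise: the height is at most \<open>L * h n k\<close>, and a factor
    \<open>m n l k\<close>, at least 1, may be inserted. The compatibility condition then collapses
    the sum to \<open>p n k\<close>.\<close>
  also have "\<dots> \<le> (\<Sum>l\<in>{1..C (Suc n)}. (L * real (h n k)) * (real (m n l k) * p (Suc n) l))"
  proof (rule sum_mono)
    fix l assume l: "l \<in> {1..C (Suc n)}"
    have "1 \<le> real (m n l k)" using m_pos[OF l k] by simp
    then have "p (Suc n) l \<le> real (m n l k) * p (Suc n) l"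
      using mult_right_mono[of 1 "real (m n l k)" "p (Suc n) l"] nn[OF l] by simp
    then show "real (h (Suc n) l) * p (Suc n) l
        \<le> (L * real (h n k)) * (real (m n l k) * p (Suc n) l)"
      using h_le[OF l k] nn[OF l] L_pos by (intro mult_mono) auto
  qed
  also have "\<dots> = L * real (h n k) * p n k"
    by (simp only: weight_systemD(3)[OF p k] sum_distrib_left)
  finally show ?thesis by (simp add: mult.assoc)
qed

lemma weight_upper_bound:
  assumes p: "weight_system C h m s p" and k: "k \<in> {1..C n}"
  shows "real (h n k) * p n k \<le> s"
proof -
  have "real (h n k) * p n k \<le> (\<Sum>k\<in>{1..C n}. real (h n k) * p n k)"
    by (rule member_le_sum) (use weight_systemD(1)[OF p] k in auto)
  then show ?thesis using weight_systemD(2)[OF p] by simp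
qed

text \<open>The lower bound for \<open>r\<close> and the upper bound for \<open>q\<close> involve
  the same height \<open>h n k\<close>, which cancels.\<close>

lemma weight_compare:
  assumes r: "weight_system C h m s r" and q: "weight_system C h m 1 q"
    and s: "0 \<le> s" and k: "k \<in> {1..C n}"
  shows "s / L * q n k \<le> r n k"
proof -
  have "real (h n k) * (s * q n k) \<le> s"
    using mult_left_mono[OF weight_upper_bound[OF q k] s] by (simp add: algebra_simps)
  also have "\<dots> \<le> real (h n k) * (L * r n k)"
    using weight_lower_bound[OF r k] by (simp add: algebra_simps)
  finally have "s * q n k \<le> L * r n k"
    using h_pos[OF k] by simp
  then show ?thesis using L_pos by (simp add: field_simps)
qed

lemma weight_contraction:
  assumes p: "weight_system C h m 1 p" and q: "weight_system C h m 1 q" and L1: "1 \<le> L"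
    and k: "k \<in> {1..C n}"
  shows "(1 - (1 - 1 / L) ^ i) * q n k \<le> p n k"
  using k
proof (induction i arbitrary: n k)
  case 0
  then show ?case using weight_systemD(1)[OF p] by simp
next
  case (Suc i)
  define d where "d = (1 - 1 / L) ^ i"
  have d: "0 \<le> d" using L1 by (simp add: d_def)
  \<comment> \<open>What is left after subtracting \<open>(1 - d) * q\<close> has total mass
    \<open>d\<close>. Comparing it with \<open>q\<close> gains another \<open>d / L\<close>, so the
    defect shrinks from \<open>d\<close> to \<open>d * (1 - 1 / L)\<close>.\<close>
  have "weight_system C h m (1 - (1 - d) * 1) (\<lambda>n k. p n k - (1 - d) * q n k)"
    using Suc.IH by (intro weight_system_diff p q) (simp add: d_def)
  from weight_compare[OF this q _ Suc.prems] d
  have "d / L * q n k \<le> p n k - (1 - d) * q n k" by simp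
  then show ?case by (simp add: d_def[symmetric] algebra_simps)
qed

lemma weight_le:
  assumes p: "weight_system C h m 1 p" and q: "weight_system C h m 1 q" and k: "k \<in> {1..C n}"
  shows "q n k \<le> p n k"
proof -
  \<comment> \<open>The lower and upper bounds on a single weight force \<open>1 \<le> L\<close>, so
    the ratio \<open>1 - 1 / L\<close> lies in [0,1) and its powers tend to 0.\<close>
  have "1 \<le> L * (real (h n k) * p n k)" by (rule weight_lower_bound[OF p k])
  also have "\<dots> \<le> L" using weight_upper_bound[OF p k] L_pos by simp
  finally have L1: "1 \<le> L" .
  have "(\<lambda>i. (1 - (1 - 1 / L) ^ i) * q n k) \<longlonglongrightarrow> (1 - 0) * q n k"
    using L1 by (intro tendsto_intros LIMSEQ_power_zero) simp
  then have "(1 - 0) * q n k \<le> p n k"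
    by (rule LIMSEQ_le_const2) (use weight_contraction[OF p q L1 k] in auto)
  then show ?thesis by simp
qed

lemma weight_unique:
  assumes "weight_system C h m 1 p" "weight_system C h m 1 q" "k \<in> {1..C n}"
  shows "p n k = q n k"
  by (rule antisym) (intro weight_le assms)+

end

section \<open>Preimages of clopen sets and Borel measurability\<close>

lemma preim_0 [simp]: "B \<subseteq> topspace X \<Longrightarrow> preim X T 0 B = B"
  by (auto simp: preim_def)

text \<open>As \<open>T\<close> keeps points inside \<open>topspace X\<close>, cutting down at the
  intermediate step loses nothing. This permits induction on \<open>j\<close>, one application of
  \<open>T\<close> at a time.\<close>

lemma preim_Suc:
  assumes "T ` topspace X \<subseteq> topspace X"
  shows "preim X T (Suc j) B = T -` preim X T j B \<inter> topspace X"
  using assms by (auto simp: preim_def funpow_swap1)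

lemma clopen_vimage:
  assumes "continuous_map X X T" "openin X B" "closedin X B"
  shows "openin X (T -` B \<inter> topspace X)" "closedin X (T -` B \<inter> topspace X)"
proof -
  have "T -` B \<inter> topspace X = {x \<in> topspace X. T x \<in> B}" by auto
  then show "openin X (T -` B \<inter> topspace X)" "closedin X (T -` B \<inter> topspace X)"
    using assms openin_continuous_map_preimage closedin_continuous_map_preimage by metis+
qed

lemma preim_clopen:
  assumes T: "continuous_map X X T" and B: "openin X B" "closedin X B"
  shows "openin X (preim X T j B) \<and> closedin X (preim X T j B)"
proof (induction j)
  case 0
  then show ?case using B by (simp add: openin_subset)
next
  case (Suc j)
  then show ?case
    using clopen_vimage[OF T] preim_Suc[OF continuous_map_image_subset_topspace[OF T]] by metis
qed

lemma space_borel_of [simp]: "space (borel_of X) = topspace X"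
  unfolding borel_of_def by (rule space_measure_of) (auto dest: openin_subset)

lemma sets_borel_of: "sets (borel_of X) = sigma_sets (topspace X) {U. openin X U}"
  unfolding borel_of_def by (rule sets_measure_of) (auto dest: openin_subset)

lemma measurable_borel_of:
  assumes T: "continuous_map X X T" and M: "sets M = sets (borel_of X)"
  shows "T \<in> measurable M M"
proof -
  have sp: "space M = topspace X" using sets_eq_imp_space_eq[OF M] by simp
  show ?thesis
  proof (rule measurable_sigma_sets)
    show "sets M = sigma_sets (topspace X) {U. openin X U}" using M by (simp add: sets_borel_of)
    show "{U. openin X U} \<subseteq> Pow (topspace X)" by (auto dest: openin_subset)
    show "T \<in> space M \<rightarrow> topspace X"
      using continuous_map_image_subset_topspace[OF T] sp by auto
    fix U assume "U \<in> {U. openin X U}"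
    then have "openin X {x \<in> topspace X. T x \<in> U}"
      using T openin_continuous_map_preimage by fastforce
    moreover have "T -` U \<inter> space M = {x \<in> topspace X. T x \<in> U}" using sp by auto
    ultimately show "T -` U \<inter> space M \<in> sets M"
      by (simp add: M sets_borel_of sigma_sets.Basic)
  qed
qed

section \<open>Existence of an invariant probability\<close>

text \<open>Normalisation and invariance are phrased through the orbit of \<open>x\<close> alone, so
  they apply directly to \<open>topspace X\<close> and to preimages cut down to it.\<close>

lemma orbit_mean_exists:
  fixes T :: "'a \<Rightarrow> 'a" and x :: 'a
  obtains \<mu> :: "'a set \<Rightarrow> real"
  where "\<And>A. 0 \<le> \<mu> A" "\<And>A. (\<And>i. (T ^^ i) x \<in> A) \<Longrightarrow> \<mu> A = 1"
    "\<And>A B. A \<inter> B = {} \<Longrightarrow> \<mu> (A \<union> B) = \<mu> A + \<mu> B"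
    "\<And>A B. (\<And>i. (T ^^ i) x \<in> B \<longleftrightarrow> (T ^^ Suc i) x \<in> A) \<Longrightarrow> \<mu> B = \<mu> A"
proof -
  \<comment> \<open>Averaging over \<open>Suc N\<close> points keeps the denominator nonzero at
    \<open>N = 0\<close>.\<close>
  define f :: "nat \<Rightarrow> 'a set \<Rightarrow> real"
    where "f N A = (\<Sum>i<Suc N. indicator A ((T ^^ i) x)) / real (Suc N)" for N A
  define K :: "('a set \<Rightarrow> real) set" where "K = (\<Pi>\<^sub>E A\<in>UNIV. {0..1})"
  have fK: "f N \<in> K" for N
  proof -
    have "f N A \<le> 1" for A
    proof -
      have "(\<Sum>i<Suc N. indicator A ((T ^^ i) x)) \<le> (\<Sum>i<Suc N. 1 :: real)"
        by (rule sum_mono) (simp add: indicator_def)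
      then show ?thesis by (simp add: f_def field_simps del: sum.lessThan_Suc)
    qed
    moreover have "0 \<le> f N A" for A
      by (simp add: f_def sum_nonneg del: sum.lessThan_Suc)
    ultimately show ?thesis by (auto simp: K_def PiE_iff)
  qed
  have "compactin (product_topology (\<lambda>_. euclidean) UNIV) K"
    unfolding K_def by (subst compactin_PiE) auto
  then have "compact K" by (simp add: euclidean_product_topology)
  moreover define F where "F = filtermap f sequentially"
  have "F \<noteq> bot" by (simp add: F_def filtermap_bot_iff)
  moreover have "eventually (\<lambda>g. g \<in> K) F" using fK by (simp add: F_def eventually_filtermap)
  ultimately obtain \<mu> where \<mu>: "\<mu> \<in> K" "inf (nhds \<mu>) F \<noteq> bot"
    unfolding compact_filter by blast
  \<comment> \<open>\<open>G\<close> acts as a convergent subnet: it lies below \<open>F\<close>,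
    hence inherits whatever holds eventually along \<open>f\<close>, and below
    \<open>nhds \<mu>\<close>, hence every coordinate converges along it.\<close>
  define G where "G = inf (nhds \<mu>) F"
  have ev: "eventually P G" if "eventually (\<lambda>N. P (f N)) sequentially" for P
    using that filter_leD[of G F P] by (simp add: G_def F_def eventually_filtermap)
  have lim: "((\<lambda>g. g A) \<longlongrightarrow> \<mu> A) G" for A
  proof -
    have "((\<lambda>g. g A) \<longlongrightarrow> \<mu> A) (nhds \<mu>)"
      by (rule tendsto_at_iff_tendsto_nhds[THEN iffD1])
        (use continuous_on_product_coordinates[of A] in \<open>auto simp: continuous_on_def\<close>)
    then show ?thesis by (rule filterlim_mono) (simp_all add: G_def)
  qed
  have nb: "G \<noteq> bot" using \<mu> by (simp add: G_def)
  show thesis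
  proof
    show "0 \<le> \<mu> A" for A using \<mu>(1) by (simp add: K_def PiE_iff)
    show "\<mu> A = 1" if "\<And>i. (T ^^ i) x \<in> A" for A
    proof -
      have "f N A = 1" for N using that by (simp add: f_def)
      then have "((\<lambda>g. g A) \<longlongrightarrow> 1) G"
        by (intro tendsto_eventually ev) simp
      then show ?thesis using lim nb tendsto_unique by blast
    qed
    show "\<mu> (A \<union> B) = \<mu> A + \<mu> B" if "A \<inter> B = {}" for A B
    proof -
      have "f N (A \<union> B) = f N A + f N B" for N
        using that by (simp add: f_def indicator_add[symmetric] indicator_disj_union
            sum.distrib add_divide_distrib del: sum.lessThan_Suc)
      then have "((\<lambda>g. g (A \<union> B)) \<longlongrightarrow> \<mu> A + \<mu> B) G \<longleftrightarrow> ((\<lambda>g. g A + g B) \<longlongrightarrow> \<mu> A + \<mu> B) G"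
        by (intro tendsto_cong ev) simp
      moreover have "((\<lambda>g. g A + g B) \<longlongrightarrow> \<mu> A + \<mu> B) G" by (intro tendsto_add lim)
      ultimately show ?thesis using lim nb tendsto_unique by blast
    qed
    show "\<mu> B = \<mu> A" if AB: "\<And>i. (T ^^ i) x \<in> B \<longleftrightarrow> (T ^^ Suc i) x \<in> A" for A B
    proof -
      have diff: "\<bar>f N B - f N A\<bar> \<le> 1 / real (Suc N)" for N
      proof -
        have "(\<Sum>i<Suc N. indicator B ((T ^^ i) x)) =
            (\<Sum>i<Suc N. indicator A ((T ^^ Suc i) x) :: real)"
          by (rule sum.cong) (use AB in \<open>auto simp: indicator_def\<close>)
        \<comment> \<open>Shifting the orbit by one step changes the sum only by its two end terms,
          so the averages of \<open>A\<close> and \<open>B\<close> differ by at most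
          \<open>1 / Suc N\<close>.\<close>
        also have "\<dots> = (\<Sum>i<Suc N. indicator A ((T ^^ i) x))
            + indicator A ((T ^^ Suc N) x) - indicator A ((T ^^ 0) x)"
          using sum.lessThan_Suc_shift[of "\<lambda>i. indicator A ((T ^^ i) x) :: real" "Suc N"]
            sum.lessThan_Suc[of "\<lambda>i. indicator A ((T ^^ i) x) :: real" "Suc N"] by linarith
        finally have "f N B - f N A =
            (indicator A ((T ^^ Suc N) x) - indicator A ((T ^^ 0) x)) / real (Suc N)"
          unfolding f_def diff_divide_distrib[symmetric] by simp
        moreover have "\<bar>indicator A ((T ^^ Suc N) x) - indicator A ((T ^^ 0) x)\<bar> \<le> (1 :: real)"
          by (simp add: indicator_def)
        ultimately show ?thesis by (simp add: abs_divide divide_right_mono)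
      qed
      have "(\<lambda>N. f N B - f N A) \<longlonglongrightarrow> 0"
        by (rule Lim_null_comparison[OF always_eventually LIMSEQ_inverse_real_of_nat])
          (use diff in \<open>simp add: divide_inverse\<close>)
      then have "((\<lambda>g. g B - g A) \<longlongrightarrow> 0) F" by (simp add: F_def filterlim_filtermap)
      then have "((\<lambda>g. g B - g A) \<longlongrightarrow> 0) G" by (rule filterlim_mono) (simp_all add: G_def)
      moreover have "((\<lambda>g. g B - g A) \<longlongrightarrow> \<mu> B - \<mu> A) G" by (intro tendsto_diff lim)
      ultimately show ?thesis using nb tendsto_unique by fastforce
    qed
  qed
qed

lemma algebra_clopen: "algebra (topspace X) {A. openin X A \<and> closedin X A}"
  unfolding algebra_iff_Un by (auto dest: openin_subset)

lemma invariant_borel_prob_exists: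
  assumes comp: "compact_space X" and ne: "topspace X \<noteq> {}" and T: "continuous_map X X T"
    and gen: "sets (borel_of X) = sigma_sets (topspace X) {A. openin X A \<and> closedin X A}"
  shows "\<exists>M. invariant_borel_prob X T M"
proof -
  let ?A = "{A. openin X A \<and> closedin X A}"
  interpret algebra "topspace X" ?A by (rule algebra_clopen)
  obtain x where x: "x \<in> topspace X" using ne by blast
  have TX: "T ` topspace X \<subseteq> topspace X" by (rule continuous_map_image_subset_topspace[OF T])
  have orb: "(T ^^ i) x \<in> topspace X" for i using x TX by (induction i) auto
  obtain \<mu> :: "'a set \<Rightarrow> real" where nn: "\<And>A. 0 \<le> \<mu> A"
    and one: "\<And>A. (\<And>i. (T ^^ i) x \<in> A) \<Longrightarrow> \<mu> A = 1"
    and add: "\<And>A B. A \<inter> B = {} \<Longrightarrow> \<mu> (A \<union> B) = \<mu> A + \<mu> B"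
    and inv: "\<And>A B. (\<And>i. (T ^^ i) x \<in> B \<longleftrightarrow> (T ^^ Suc i) x \<in> A) \<Longrightarrow> \<mu> B = \<mu> A"
    by (rule orbit_mean_exists[of T x]) (auto simp del: funpow.simps)
  have empty: "\<mu> {} = 0" using add[of "{}" "{}"] by simp
  have "\<exists>\<nu> :: 'a set \<Rightarrow> ennreal. (\<forall>s\<in>?A. \<nu> s = ennreal (\<mu> s)) \<and>
      measure_space (topspace X) (sigma_sets (topspace X) ?A) \<nu>"
  proof (rule caratheodory_empty_continuous)
    show "positive ?A (\<lambda>s. ennreal (\<mu> s))" by (simp add: positive_def empty)
    show "additive ?A (\<lambda>s. ennreal (\<mu> s))"
      by (simp add: additive_def add nn)
    fix A :: "nat \<Rightarrow> 'a set"
    assume A: "range A \<subseteq> ?A" "decseq A" "(\<Inter>i. A i) = {}"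
    \<comment> \<open>Nonempty nested closed sets in a compact space have a common point, so some
      \<open>A n\<close> is already empty. This is the continuity at the empty set that the
      Caratheodory extension asks for.\<close>
    then obtain n where n: "A n = {}"
      using compact_space_imp_nest[OF comp, of A] by blast
    have "A i = {}" if "n \<le> i" for i using n decseqD[OF A(2) that] by simp
    then show "(\<lambda>i. ennreal (\<mu> (A i))) \<longlonglongrightarrow> 0"
      by (intro tendsto_eventually) (auto simp: eventually_sequentially empty intro!: exI[of _ n])
  qed simp
  then obtain \<nu> :: "'a set \<Rightarrow> ennreal" where \<nu>: "\<And>s. s \<in> ?A \<Longrightarrow> \<nu> s = ennreal (\<mu> s)"
    and ms: "measure_space (topspace X) (sigma_sets (topspace X) ?A) \<nu>"
    by blast
  define M where "M = measure_of (topspace X) ?A \<nu>"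
  have sub: "?A \<subseteq> Pow (topspace X)" by (auto dest: openin_subset)
  have sp: "space M = topspace X" unfolding M_def by (rule space_measure_of[OF sub])
  have st: "sets M = sigma_sets (topspace X) ?A" unfolding M_def by (rule sets_measure_of[OF sub])
  have em: "emeasure M A = ennreal (\<mu> A)" if "A \<in> ?A" for A
    using emeasure_measure_of_sigma[of "topspace X" "sigma_sets (topspace X) ?A" \<nu> A] ms \<nu>[OF that] that
    by (simp add: M_def measure_space_def sub emeasure_measure_of sigma_sets.Basic)
  have "emeasure M (space M) = 1"
    using em[OF top] one[OF orb] by (simp add: sp)
  then have ps: "prob_space M" by (rule prob_spaceI)
  then interpret prob_space M .
  have stb: "sets M = sets (borel_of X)" using st gen by simp
  have meas: "T \<in> measurable M M" by (rule measurable_borel_of[OF T stb])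
  \<comment> \<open>Invariance is equality of \<open>M\<close> with its image under
    \<open>T\<close>, so it suffices to test the intersection-stable family of clopen
    generators.\<close>
  have "distr M M T = M"
  proof (rule measure_eqI_generator_eq[where E = ?A and \<Omega> = "topspace X" and A = "\<lambda>_. topspace X"])
    show "Int_stable ?A" by (auto simp: Int_stable_def)
    fix A assume A: "A \<in> ?A"
    have "emeasure (distr M M T) A = emeasure M (T -` A \<inter> topspace X)"
      using meas A st by (simp add: emeasure_distr sigma_sets.Basic sp)
    also have "\<dots> = ennreal (\<mu> (T -` A \<inter> topspace X))"
      using A clopen_vimage[OF T] by (intro em) simp
    \<comment> \<open>The orbit stays in \<open>topspace X\<close>, so an orbit point lies in the
      cut-down preimage exactly when its successor lies in \<open>A\<close>.\<close>
    also have "\<mu> (T -` A \<inter> topspace X) = \<mu> A" by (rule inv) (use orb in auto)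
    finally show "emeasure (distr M M T) A = emeasure M A" using em[OF A] by simp
  next
    show "emeasure (distr M M T) (topspace X) \<noteq> \<infinity>" for i :: nat
      using meas by (metis prob_space.emeasure_space_1 prob_space_distr sp space_distr ennreal_one_neq_top infinity_ennreal_def)
  qed (use sub st in auto)
  then have "emeasure M (T -` A \<inter> space M) = emeasure M A" if "A \<in> sets M" for A
    using emeasure_distr[OF meas that] by simp
  then show ?thesis using ps stb unfolding invariant_borel_prob_def by blast
qed

section \<open>Invariant measures on nested tower partitions\<close>

text \<open>Each step uses invariance once. Consequently all floors of a tower carry the mass of its
  base.\<close>

lemma measure_preim:
  assumes M: "invariant_borel_prob X T M" and T: "continuous_map X X T"
    and B: "openin X B" "closedin X B"
  shows "measure M (preim X T j B) = measure M B"
proof (induction j)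
  case 0
  then show ?case using B by (simp add: openin_subset)
next
  case (Suc j)
  have st: "sets M = sets (borel_of X)" using M by (simp add: invariant_borel_prob_def)
  have sp: "space M = topspace X" using sets_eq_imp_space_eq[OF st] by simp
  have "preim X T j B \<in> sets M"
    using preim_clopen[OF T B, of j] by (simp add: st sets_borel_of sigma_sets.Basic)
  then have "emeasure M (T -` preim X T j B \<inter> space M) = emeasure M (preim X T j B)"
    using M by (simp add: invariant_borel_prob_def)
  then show ?case
    using Suc.IH
    by (simp add: measure_def sp preim_Suc[OF continuous_map_image_subset_topspace[OF T]])
qed

locale nested_ckr =
  fixes X :: "'a topology" and T :: "'a \<Rightarrow> 'a" and C :: "nat \<Rightarrow> nat"
    and B :: "nat \<Rightarrow> nat \<Rightarrow> 'a set" and h :: "nat \<Rightarrow> nat \<Rightarrow> nat"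
  assumes T: "continuous_map X X T"
    and seq: "ckr_sequence X T C B h"
    and refine: "KR2 X T C B h"
    and span: "KR4 X T C B h"
begin

abbreviation cells :: "nat \<Rightarrow> 'a set set" where
  "cells n \<equiv> ckr_cells X T (C n) (B n) (h n)"

abbreviation cell :: "nat \<Rightarrow> nat \<times> nat \<Rightarrow> 'a set" where
  "cell n \<equiv> (\<lambda>(k, j). preim X T j (B n k))"

abbreviation indices :: "nat \<Rightarrow> (nat \<times> nat) set" where
  "indices n \<equiv> (SIGMA k:{1..C n}. {..<h n k})"

lemma cells_eq: "cells n = cell n ` indices n"
  unfolding ckr_cells_def by force

lemma part: "ckr_partition X T (C n) (B n) (h n)"
  using seq by (simp add: ckr_sequence_def)

lemma base:
  assumes "k \<in> {1..C n}"
  shows "openin X (B n k)" "closedin X (B n k)" "B n k \<noteq> {}" "B n k \<subseteq> topspace X" "0 < h n k"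
proof -
  show "openin X (B n k)" "closedin X (B n k)" "B n k \<noteq> {}" "0 < h n k"
    using part[of n] assms by (auto simp: ckr_partition_def)
  then show "B n k \<subseteq> topspace X" by (intro openin_subset)
qed

lemma base_in_cells: "k \<in> {1..C n} \<Longrightarrow> B n k \<in> cells n"
  unfolding cells_eq using base[of k n] by (intro image_eqI[of _ _ "(k, 0)"]) auto

lemma cells_clopen: "P \<in> cells n \<Longrightarrow> openin X P \<and> closedin X P"
  unfolding cells_eq using preim_clopen[OF T base(1,2)] by auto

lemma disjoint_cells: "disjoint_family_on (cell n) (indices n)"
  using part by (simp add: ckr_partition_def)

lemma cells_cover: "\<Union> (cells n) = topspace X"
  using part by (simp add: ckr_partition_def)

lemma cells_unique:
  assumes "P \<in> cells n" "Q \<in> cells n" "x \<in> P" "x \<in> Q"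
  shows "P = Q"
proof -
  obtain a b where "a \<in> indices n" "P = cell n a" "b \<in> indices n" "Q = cell n b"
    using assms(1,2) unfolding cells_eq by blast
  moreover have "a = b"
  proof (rule ccontr)
    assume "a \<noteq> b"
    then have "cell n a \<inter> cell n b = {}"
      using disjoint_family_onD[OF disjoint_cells] \<open>a \<in> indices n\<close> \<open>b \<in> indices n\<close> by simp
    then show False
      using assms(3,4) \<open>P = cell n a\<close> \<open>Q = cell n b\<close> by blast
  qed
  ultimately show ?thesis by simp
qed

lemma cells_refine:
  assumes "m \<le> n" "P \<in> cells n"
  shows "\<exists>Q\<in>cells m. P \<subseteq> Q"
  using assms
proof (induction n arbitrary: P rule: dec_induct)
  case base
  then show ?case by blast
next
  case (step n)
  then obtain R where R: "R \<in> cells n" "P \<subseteq> R" using refine unfolding KR2_def by blast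
  obtain Q where "Q \<in> cells m" "R \<subseteq> Q" using step.IH[OF R(1)] by blast
  with R(2) show ?case by (meson order_trans)
qed

text \<open>By (KR2) \<open>P\<close> lies in some cell of level \<open>m\<close>, which meets
  \<open>Q\<close> in \<open>x\<close> and therefore equals \<open>Q\<close>. Hence any two cells,
  of whatever levels, are nested or disjoint.\<close>

lemma cells_nested:
  assumes "m \<le> n" "P \<in> cells n" "Q \<in> cells m" "x \<in> P" "x \<in> Q"
  shows "P \<subseteq> Q"
proof -
  obtain R where R: "R \<in> cells m" "P \<subseteq> R" using cells_refine[OF assms(1,2)] by blast
  then have "R = Q" using cells_unique[of R m Q x] assms(3-5) by blast
  then show ?thesis using R(2) by simp
qed

text \<open>(KR4) only makes the cells a subbase. Of two cells containing \<open>x\<close> one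
  contains the other, so finite intersections produce nothing smaller and the cells form a
  base.\<close>

lemma openin_cell:
  assumes "openin X U" "x \<in> U"
  shows "\<exists>n. \<exists>P\<in>cells n. x \<in> P \<and> P \<subseteq> U"
proof -
  have "generate_topology_on (\<Union>n. cells n) U"
    using assms(1) span unfolding KR4_def by (metis openin_topology_generated_by)
  then show ?thesis using assms(2)
  proof (induction arbitrary: x rule: generate_topology_on.induct)
    case (Int a b)
    then obtain m n P Q where PQ: "P \<in> cells m" "x \<in> P" "P \<subseteq> a" "Q \<in> cells n" "x \<in> Q" "Q \<subseteq> b"
      by blast
    show ?case
    proof (cases "m \<le> n")
      case True
      then have "Q \<subseteq> P" using cells_nested PQ by blast
      then show ?thesis using PQ by blast
    next
      case False
      then have "P \<subseteq> Q" using cells_nested[of n m] PQ by auto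
      then show ?thesis using PQ by blast
    qed
  next
    case (UN K)
    then obtain k where k: "k \<in> K" "x \<in> k" by blast
    then show ?case using UN.IH[OF k] by blast
  next
    case (Basis s)
    then show ?case by blast
  qed simp
qed

lemma countable_cells: "countable (\<Union>n. cells n)"
proof -
  have "finite (cells n)" for n unfolding cells_eq by (intro finite_imageI finite_SigmaI) auto
  then show ?thesis by (simp add: countable_finite)
qed

lemma cells_subset_topspace: "(\<Union>n. cells n) \<subseteq> Pow (topspace X)"
  using cells_cover by blast

text \<open>An open set is the union of the cells inside it, and there are only countably many
  cells.\<close>

lemma sets_borel_of_cells: "sets (borel_of X) = sigma_sets (topspace X) (\<Union>n. cells n)"
  unfolding sets_borel_of
proof (rule sigma_sets_eqI)
  fix U assume "U \<in> {U. openin X U}"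
  then have U: "openin X U" by simp
  interpret S: sigma_algebra "topspace X" "sigma_sets (topspace X) (\<Union>n. cells n)"
    by (rule sigma_algebra_sigma_sets[OF cells_subset_topspace])
  let ?F = "{P \<in> \<Union>n. cells n. P \<subseteq> U}"
  have "\<Union> ?F \<in> sigma_sets (topspace X) (\<Union>n. cells n)"
    by (intro S.countable_Union countable_subset[OF _ countable_cells])
      (auto intro: sigma_sets.Basic)
  moreover have "\<Union> ?F = U" using openin_cell[OF U] by blast
  ultimately show "U \<in> sigma_sets (topspace X) (\<Union>n. cells n)" by simp
next
  fix P assume "P \<in> (\<Union>n. cells n)"
  then show "P \<in> sigma_sets (topspace X) {U. openin X U}"
    using cells_clopen by (auto intro: sigma_sets.Basic)
qed

text \<open>The clopen sets lie between the cells and the open sets, two families that generate the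
  same sigma-algebra.\<close>

lemma sets_borel_of_clopen:
  "sets (borel_of X) = sigma_sets (topspace X) {A. openin X A \<and> closedin X A}"
proof
  show "sets (borel_of X) \<subseteq> sigma_sets (topspace X) {A. openin X A \<and> closedin X A}"
    unfolding sets_borel_of_cells by (rule sigma_sets_mono') (use cells_clopen in blast)
  show "sigma_sets (topspace X) {A. openin X A \<and> closedin X A} \<subseteq> sets (borel_of X)"
    unfolding sets_borel_of by (rule sigma_sets_mono') blast
qed

text \<open>How often tower \<open>l\<close> of level \<open>n + 1\<close> visits the base \<open>B n k\<close>.\<close>

definition mult :: "nat \<Rightarrow> nat \<Rightarrow> nat \<Rightarrow> nat" where
  "mult n l k = card {j. j < h (Suc n) l \<and> preim X T j (B (Suc n) l) \<subseteq> B n k}"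

text \<open>\<open>J k\<close> selects floors of tower \<open>k\<close>. Taking all floors yields
  the total mass; taking the floors inside a coarser base yields the compatibility of
  weights.\<close>

lemma measure_Union_cells:
  assumes M: "invariant_borel_prob X T M" and J: "\<And>k. k \<in> {1..C n} \<Longrightarrow> J k \<subseteq> {..<h n k}"
  shows "measure M (\<Union>i\<in>(SIGMA k:{1..C n}. J k). cell n i)
      = (\<Sum>k\<in>{1..C n}. real (card (J k)) * measure M (B n k))"
proof -
  interpret prob_space M using M by (simp add: invariant_borel_prob_def)
  have st: "sets M = sets (borel_of X)" using M by (simp add: invariant_borel_prob_def)
  have fin: "finite (J k)" if "k \<in> {1..C n}" for k
    using J[OF that] finite_subset by blast
  have sub: "(SIGMA k:{1..C n}. J k) \<subseteq> indices n" using J by blast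
  have "measure M (\<Union>i\<in>(SIGMA k:{1..C n}. J k). cell n i)
      = (\<Sum>i\<in>(SIGMA k:{1..C n}. J k). measure M (cell n i))"
  proof (rule finite_measure_finite_Union)
    show "finite (SIGMA k:{1..C n}. J k)" using fin by (intro finite_SigmaI) auto
    have "cell n ` (SIGMA k:{1..C n}. J k) \<subseteq> cells n"
      unfolding cells_eq using sub by (rule image_mono)
    then show "cell n ` (SIGMA k:{1..C n}. J k) \<subseteq> sets M"
      using st sets_borel_of_cells sigma_sets.Basic by fastforce
    show "disjoint_family_on (cell n) (SIGMA k:{1..C n}. J k)"
      using disjoint_family_on_mono[OF sub disjoint_cells] .
  qed
  also have "\<dots> = (\<Sum>k\<in>{1..C n}. \<Sum>j\<in>J k. measure M (preim X T j (B n k)))"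
    using fin by (subst sum.Sigma) (auto simp: case_prod_beta)
  also have "\<dots> = (\<Sum>k\<in>{1..C n}. real (card (J k)) * measure M (B n k))"
    by (intro sum.cong refl) (use measure_preim[OF M T] base in simp)
  finally show ?thesis .
qed

lemma weight_system_measure:
  assumes M: "invariant_borel_prob X T M"
  shows "weight_system C h mult 1 (\<lambda>n k. measure M (B n k))"
  unfolding weight_system_def
proof (intro conjI allI ballI)
  interpret prob_space M using M by (simp add: invariant_borel_prob_def)
  have st: "sets M = sets (borel_of X)" using M by (simp add: invariant_borel_prob_def)
  have sp: "space M = topspace X" using sets_eq_imp_space_eq[OF st] by simp
  fix n
  show "(\<Sum>k\<in>{1..C n}. real (h n k) * measure M (B n k)) = 1"
    using measure_Union_cells[OF M, of n "\<lambda>k. {..<h n k}"] cells_cover[of n] prob_space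
    by (simp add: cells_eq sp)
  fix k assume k: "k \<in> {1..C n}"
  show "0 \<le> measure M (B n k)" by simp
  let ?J = "\<lambda>l. {j. j < h (Suc n) l \<and> preim X T j (B (Suc n) l) \<subseteq> B n k}"
  \<comment> \<open>\<open>B n k\<close> is itself a cell, so a cell of level \<open>n + 1\<close>
    that meets it lies inside it; these floors therefore exhaust \<open>B n k\<close>.\<close>
  have eq: "B n k = (\<Union>i\<in>(SIGMA l:{1..C (Suc n)}. ?J l). cell (Suc n) i)"
  proof
    show "B n k \<subseteq> (\<Union>i\<in>(SIGMA l:{1..C (Suc n)}. ?J l). cell (Suc n) i)"
    proof
      fix x assume x: "x \<in> B n k"
      then have "x \<in> \<Union> (cells (Suc n))" using base(4)[OF k] cells_cover by blast
      then obtain i where i: "i \<in> indices (Suc n)" "x \<in> cell (Suc n) i"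
        unfolding cells_eq by blast
      then have "cell (Suc n) i \<subseteq> B n k"
        using cells_nested[of n "Suc n" "cell (Suc n) i" "B n k" x] base_in_cells[OF k] x
        unfolding cells_eq by auto
      then show "x \<in> (\<Union>i\<in>(SIGMA l:{1..C (Suc n)}. ?J l). cell (Suc n) i)"
        using i by auto
    qed
  qed auto
  have "measure M (\<Union>i\<in>(SIGMA l:{1..C (Suc n)}. ?J l). cell (Suc n) i) =
      (\<Sum>l\<in>{1..C (Suc n)}. real (mult n l k) * measure M (B (Suc n) l))"
    unfolding mult_def by (rule measure_Union_cells[OF M]) auto
  then show "measure M (B n k) =
      (\<Sum>l\<in>{1..C (Suc n)}. real (mult n l k) * measure M (B (Suc n) l))"
    unfolding eq[symmetric] .
qed

text \<open>Both measures yield weights for the same incidence numbers, so they agree on the bases,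
  then by invariance on all cells, and these generate the Borel sets.\<close>

lemma invariant_borel_prob_unique:
  assumes lr: "LR L C h" and KR5: "KR5 X T C B h"
    and M: "invariant_borel_prob X T M" and N: "invariant_borel_prob X T N"
  shows "M = N"
proof -
  have C1: "1 \<in> {1..C n}" for n using part[of n] by (simp add: ckr_partition_def)
  have hL: "real (h (Suc n) l) \<le> L * real (h n k)"
    if "l \<in> {1..C (Suc n)}" "k \<in> {1..C n}" for n l k
    using lr that unfolding LR_def by (metis diff_Suc_1 le_add1 plus_1_eq_Suc)
  interpret linearly_bounded_towers C h mult L
  proof
    \<comment> \<open>(LR) puts no sign on \<open>L\<close>; it is forced by comparing the positive
      heights of levels 1 and 0.\<close>
    have "0 < L * real (h 0 1)"
      using hL[OF C1 C1, of 0] base(5)[OF C1, of "Suc 0"] by linarith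
    then show "0 < L" by (simp add: zero_less_mult_iff)
    fix n l k
    assume lk: "l \<in> {1..C (Suc n)}" "k \<in> {1..C n}"
    have "\<exists>j<h (Suc n) l. preim X T j (B (Suc n) l) \<subseteq> B n k"
      using KR5 lk unfolding KR5_def by (metis diff_Suc_1 le_add1 plus_1_eq_Suc)
    then show "0 < mult n l k" unfolding mult_def by (auto simp: card_gt_0_iff)
  qed (use base hL in auto)
  interpret M: prob_space M using M by (simp add: invariant_borel_prob_def)
  interpret N: prob_space N using N by (simp add: invariant_borel_prob_def)
  have eq: "measure M (B n k) = measure N (B n k)" if "k \<in> {1..C n}" for n k
    using weight_unique[OF weight_system_measure[OF M] weight_system_measure[OF N] that] .
  show ?thesis
  proof (rule measure_eqI_generator_eq_countable
      [where E = "insert {} (\<Union>n. cells n)" and \<Omega> = "topspace X" and A = "cells 0"])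
    \<comment> \<open>The empty set is adjoined because disjoint cells intersect in it; in the
      remaining case the cells are nested and the intersection is one of them.\<close>
    show "Int_stable (insert {} (\<Union>n. cells n))"
    proof (rule Int_stableI)
      fix P Q assume "P \<in> insert {} (\<Union>n. cells n)" "Q \<in> insert {} (\<Union>n. cells n)"
      then consider "P \<inter> Q = {}" | m n where "P \<in> cells m" "Q \<in> cells n" "P \<inter> Q \<noteq> {}" by blast
      then show "P \<inter> Q \<in> insert {} (\<Union>n. cells n)"
      proof cases
        case 2
        then have "P \<subseteq> Q \<or> Q \<subseteq> P" using cells_nested by (metis disjoint_iff linorder_linear)
        then have "P \<inter> Q = P \<or> P \<inter> Q = Q" by blast
        then show ?thesis using 2 by auto
      qed simp
    qed
    fix P assume "P \<in> insert {} (\<Union>n. cells n)"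
    then consider "P = {}" | n i where "i \<in> indices n" "P = cell n i"
      unfolding cells_eq by blast
    then have "measure M P = measure N P"
    proof cases
      case 2
      then show ?thesis
        using measure_preim[OF M T] measure_preim[OF N T] base eq by auto
    qed simp
    then show "emeasure M P = emeasure N P"
      by (simp add: M.emeasure_eq_measure N.emeasure_eq_measure)
  next
    have *: "sigma_sets (topspace X) (insert {} (\<Union>n. cells n)) = sets (borel_of X)"
      unfolding sets_borel_of_cells
      by (rule sigma_sets_eqI) (auto intro: sigma_sets.Basic sigma_sets.Empty)
    show "sets M = sigma_sets (topspace X) (insert {} (\<Union>n. cells n))"
      "sets N = sigma_sets (topspace X) (insert {} (\<Union>n. cells n))"
      using M N * by (simp_all add: invariant_borel_prob_def)
    show "countable (cells 0)" using countable_cells by (rule countable_subset[rotated]) blast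
    show "\<Union> (cells 0) = topspace X" by (rule cells_cover)
    show "insert {} (\<Union>n. cells n) \<subseteq> Pow (topspace X)" using cells_subset_topspace by simp
  qed auto
qed

end

theorem proposition5:
  fixes X :: "'a topology" and T :: "'a \<Rightarrow> 'a"
  assumes "linearly_recurrent X T"
  shows "uniquely_ergodic X T"
proof -
  obtain C B h L where "ckr_sequence X T C B h" "KR2 X T C B h" "KR4 X T C B h"
    and KR5: "KR5 X T C B h" and LR: "LR L C h"
    using assms unfolding linearly_recurrent_def by blast
  moreover have X: "cantor_space X" and hom: "homeomorphic_map X X T"
    using assms
    unfolding linearly_recurrent_def minimal_cantor_system_def cantor_system_def by blast+
  moreover have T: "continuous_map X X T"
    by (rule homeomorphic_imp_continuous_map[OF hom])
  ultimately interpret nested_ckr X T C B h by unfold_locales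
  \<comment> \<open>Compactness and a nonempty space come from the Cantor property; the clopen
    generation of the Borel sets comes from (KR2) and (KR4).\<close>
  have "\<exists>M. invariant_borel_prob X T M"
    using X unfolding cantor_space_def
    by (intro invariant_borel_prob_exists T sets_borel_of_clopen) blast+
  then show ?thesis
    unfolding uniquely_ergodic_def using invariant_borel_prob_unique[OF LR KR5] by blast
qed

end
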